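(* Let $A=\bigoplus_{i\in\mathsf{I}}X_i^\dagger X_i$ be a point of $\mathsf{C}$, with $X_i\in\mathcal{B}(\mathcal{H})$, and let $r_i=\mathrm{rank}(X_i)$. If $A$ is an extreme point of $\mathsf{C}$, then $$\sum_{i\in\mathsf{I}}r_i^2\ \le\ \sum_{\mu\in\mathsf{S}}m_\mu^2 .$$
   Context: $\mathbf{G}$ is a compact Lie group (finite groups included) with Haar measure $dg$ normalized by $\int_{\mathbf{G}}dg=1$. $\mathcal{H}$ is a finite-dimensional complex Hilbert space and $\{U_g\mid g\in\mathbf{G}\}$ is a (generally projective) unitary representation of $\mathbf{G}$ on $\mathcal{H}$, with $g\mapsto U_gXU_g^\dagger$ continuous for every operator $X$. $\mathcal{B}(\mathcal{K})$ denotes the linear operators on $\mathcal{K}$. $\mathsf{S}$ is the set of equivalence classes of irreducible representations occurring in the decomposition of $\{U_g\}$, and $m_\mu$ is the multiplicity of $\mu\in\mathsf{S}$. $\mathsf{I}$ is a finite index set, and $\mathcal{W}_i\simeq\mathcal{H}$ is a copy of $\mathcal{H}$ for each $i\in\mathsf{I}$. A block operator is an element $A=\bigoplus_{i\in\mathsf{I}}A_i$ of $\bigoplus_{i\in\mathsf{I}}\mathcal{B}(\mathcal{W}_i)$. The convex set $\mathsf{C}$ consists of all block operators $A$ with $A\ge 0$ and $$\sum_{i\in\mathsf{I}}\int_{\mathbf{G}}dg\,U_gA_iU_g^\dagger=1_{\mathcal H}.$$ ($\mathsf{C}$ is in affine bijection with the covariant POVMs with outcome space $\mathsf{I}\times\mathbf{G}$,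 with operator density $M(i,g)=U_gA_iU_g^\dagger$.) *)

theory Defs
  imports "HOL-Analysis.Analysis" "HOL-Algebra.Coset"
begin

section \<open>Compact Lie groups\<close>

primrec Ck_on :: "nat \<Rightarrow> 'a::euclidean_space set \<Rightarrow> ('a \<Rightarrow> 'b::euclidean_space) \<Rightarrow> bool" where
  "Ck_on 0 S f \<longleftrightarrow> continuous_on S f"
| "Ck_on (Suc k) S f \<longleftrightarrow>
     (\<forall>x\<in>S. f differentiable (at x)) \<and> (\<forall>v. Ck_on k S (\<lambda>x. frechet_derivative f (at x) v))"

text \<open>Smoothness on a set that need not be open in the ambient space: local extendability to a
  smooth map. For relatively open subsets of a linear subspace (the only use below) this is
  ordinary smoothness of maps between open subsets of finite-dimensional vector spaces.\<close>

definition smooth_map_on :: "'a::euclidean_space set \<Rightarrow> ('a \<Rightarrow> 'b::euclidean_space) \<Rightarrow> bool" where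
  "smooth_map_on S f \<longleftrightarrow>
     (\<forall>x\<in>S. \<exists>N F. open N \<and> x \<in> N \<and> (\<forall>k. Ck_on k N F) \<and> (\<forall>y\<in>S \<inter> N. F y = f y))"

text \<open>The charts \<open>(N, \<phi>)\<close> take values in a linear subspace \<open>E\<close> of a Euclidean space. Types of class
  \<open>euclidean_space\<close> have positive dimension, so \<open>E = {0}\<close> is what makes finite groups Lie groups.\<close>

locale compact_lie_group = group G
  for G :: "('g, 'm) monoid_scheme" (structure) +
  fixes T :: "'g topology"
    and E :: "'e::euclidean_space set"
    and charts :: "('g set \<times> ('g \<Rightarrow> 'e)) set"
  assumes topspace_eq: "topspace T = carrier G"
    and Hausdorff: "Hausdorff_space T"
    and compact: "compact_space T"
    and continuous_mult: "continuous_map (prod_topology T T) T (\<lambda>(g, h). g \<otimes> h)"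
    and continuous_inv: "continuous_map T T (\<lambda>g. inv g)"
    and subspace_model: "subspace E"
    and charts_cover: "(\<Union>(N, \<phi>)\<in>charts. N) = carrier G"
    and chart_domain: "(N, \<phi>) \<in> charts \<Longrightarrow> openin T N"
    and chart_range: "(N, \<phi>) \<in> charts \<Longrightarrow> openin (top_of_set E) (\<phi> ` N)"
    and chart_homeo: "(N, \<phi>) \<in> charts \<Longrightarrow>
          homeomorphic_map (subtopology T N) (top_of_set (\<phi> ` N)) \<phi>"
    and smooth_transition: "\<lbrakk>(N, \<phi>) \<in> charts; (N', \<phi>') \<in> charts\<rbrakk> \<Longrightarrow>
          smooth_map_on (\<phi> ` (N \<inter> N')) (\<lambda>x. \<phi>' (inv_into N \<phi> x))"
    and smooth_mult: "\<lbrakk>(N, \<phi>) \<in> charts; (N', \<phi>') \<in> charts; (N'', \<phi>'') \<in> charts\<rbrakk> \<Longrightarrow>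
          smooth_map_on {(\<phi> g, \<phi>' h) | g h. g \<in> N \<and> h \<in> N' \<and> g \<otimes> h \<in> N''}
            (\<lambda>(x, y). \<phi>'' (inv_into N \<phi> x \<otimes> inv_into N' \<phi>' y))"
    and smooth_inv: "\<lbrakk>(N, \<phi>) \<in> charts; (N', \<phi>') \<in> charts\<rbrakk> \<Longrightarrow>
          smooth_map_on {\<phi> g | g. g \<in> N \<and> inv g \<in> N'} (\<lambda>x. \<phi>' (inv (inv_into N \<phi> x)))"

text \<open>A compact Lie group is metrizable, so regularity of a finite Borel measure is automatic, and
  it is unimodular, so left invariance suffices.\<close>

definition normalized_haar_measure ::
    "('g, 'm) monoid_scheme \<Rightarrow> 'g topology \<Rightarrow> 'g measure \<Rightarrow> bool" where
  "normalized_haar_measure G T M \<longleftrightarrow>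
     space M = carrier G \<and>
     sets M = sigma_sets (carrier G) {N. openin T N} \<and>
     emeasure M (carrier G) = 1 \<and>
     (\<forall>g\<in>carrier G. \<forall>B\<in>sets M. emeasure M (g <#\<^bsub>G\<^esub> B) = emeasure M B)"


section \<open>Operators on a finite-dimensional complex Hilbert space\<close>

definition cinner :: "complex^'n \<Rightarrow> complex^'n \<Rightarrow> complex" where
  "cinner x y = (\<Sum>i\<in>UNIV. cnj (x $ i) * y $ i)"

definition adj :: "complex^'n^'m \<Rightarrow> complex^'m^'n" where
  "adj A = map_matrix cnj (transpose A)"

definition unitary :: "complex^'n^'n \<Rightarrow> bool" where
  "unitary A \<longleftrightarrow> adj A ** A = mat 1 \<and> A ** adj A = mat 1"

definition pos_op :: "complex^'n^'n \<Rightarrow> bool" where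
  "pos_op A \<longleftrightarrow> (\<forall>x. cinner x (A *v x) \<in> \<real> \<and> 0 \<le> Re (cinner x (A *v x)))"


section \<open>Projective unitary representations\<close>

definition projective_rep ::
    "('g, 'm) monoid_scheme \<Rightarrow> 'g topology \<Rightarrow> ('g \<Rightarrow> complex^'n^'n) \<Rightarrow> bool" where
  "projective_rep G T U \<longleftrightarrow>
     (\<forall>g\<in>carrier G. unitary (U g)) \<and>
     (\<exists>\<omega>. \<forall>g\<in>carrier G. \<forall>h\<in>carrier G.
        cmod (\<omega> g h) = 1 \<and> U g ** U h = mat (\<omega> g h) ** U (g \<otimes>\<^bsub>G\<^esub> h)) \<and>
     (\<forall>X. continuous_map T euclidean (\<lambda>g. U g ** X ** adj (U g)))"

definition invariant_subspace ::
    "('g, 'm) monoid_scheme \<Rightarrow> ('g \<Rightarrow> complex^'n^'n) \<Rightarrow> (complex^'n) set \<Rightarrow> bool" where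
  "invariant_subspace G U W \<longleftrightarrow>
     vec.subspace W \<and> (\<forall>g\<in>carrier G. \<forall>w\<in>W. U g *v w \<in> W)"

definition irreducible_subspace ::
    "('g, 'm) monoid_scheme \<Rightarrow> ('g \<Rightarrow> complex^'n^'n) \<Rightarrow> (complex^'n) set \<Rightarrow> bool" where
  "irreducible_subspace G U W \<longleftrightarrow>
     invariant_subspace G U W \<and> W \<noteq> {0} \<and>
     (\<forall>V. invariant_subspace G U V \<and> V \<subseteq> W \<longrightarrow> V = {0} \<or> V = W)"

text \<open>Only the restriction of the matrix \<open>R\<close> to \<open>V\<close> matters. All subrepresentations of \<open>U\<close> carry the
  same multiplier, and an equivalence intertwines them exactly, not merely up to phases.\<close>

definition equivalent_subreps ::
    "('g, 'm) monoid_scheme \<Rightarrow> ('g \<Rightarrow> complex^'n^'n) \<Rightarrow> (complex^'n) set \<Rightarrow> (complex^'n) set \<Rightarrow> bool"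
  where
  "equivalent_subreps G U V W \<longleftrightarrow>
     (\<exists>R::complex^'n^'n. bij_betw ((*v) R) V W \<and>
        (\<forall>g\<in>carrier G. \<forall>v\<in>V. R *v (U g *v v) = U g *v (R *v v)))"

text \<open>Orthogonal decomposition into irreducible subrepresentations, given by the set of its
  summands.\<close>

definition irrep_decomposition ::
    "('g, 'm) monoid_scheme \<Rightarrow> ('g \<Rightarrow> complex^'n^'n) \<Rightarrow> (complex^'n) set set \<Rightarrow> bool" where
  "irrep_decomposition G U D \<longleftrightarrow>
     finite D \<and>
     (\<forall>W\<in>D. irreducible_subspace G U W) \<and>
     (\<forall>V\<in>D. \<forall>W\<in>D. V \<noteq> W \<longrightarrow> (\<forall>v\<in>V. \<forall>w\<in>W. cinner v w = 0)) \<and>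
     vec.span (\<Union>D) = UNIV"

definition irrep_classes ::
    "('g, 'm) monoid_scheme \<Rightarrow> ('g \<Rightarrow> complex^'n^'n) \<Rightarrow> (complex^'n) set set \<Rightarrow> (complex^'n) set set set"
  where
  "irrep_classes G U D = D // {(V, W). V \<in> D \<and> W \<in> D \<and> equivalent_subreps G U V W}"

definition multiplicity_in :: "(complex^'n) set set \<Rightarrow> (complex^'n) set set \<Rightarrow> nat" where
  "multiplicity_in D \<mu> = card {W \<in> D. W \<in> \<mu>}"


section \<open>Seeds of covariant POVMs\<close>

text \<open>A block operator is the tuple of its blocks.\<close>

definition seed_set ::
    "'g measure \<Rightarrow> ('g \<Rightarrow> complex^'n^'n) \<Rightarrow> (complex^'n^'n^'i) set" where
  "seed_set M U =
     {A. (\<forall>i. pos_op (A $ i)) \<and>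
         (\<Sum>i\<in>UNIV. \<integral>g. U g ** (A $ i) ** adj (U g) \<partial>M) = mat 1}"


section \<open>Existence of irreducible decompositions\<close>

lemma cinner_adj: "cinner x (A *v y) = cinner (adj A *v x) y"
proof -
  have "cinner x (A *v y) = (\<Sum>i\<in>UNIV. \<Sum>j\<in>UNIV. cnj (x $ i) * (A $ i $ j * y $ j))"
    by (simp add: cinner_def matrix_vector_mult_def sum_distrib_left)
  also have "\<dots> = (\<Sum>j\<in>UNIV. \<Sum>i\<in>UNIV. cnj (x $ i) * (A $ i $ j * y $ j))"
    by (rule sum.swap)
  also have "\<dots> = cinner (adj A *v x) y"
    by (simp add: cinner_def matrix_vector_mult_def adj_def transpose_def sum_distrib_right
        sum_distrib_left mult_ac)
  finally show ?thesis .
qed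

lemma cinner_add_right: "cinner x (y + z) = cinner x y + cinner x z"
  by (simp add: cinner_def algebra_simps sum.distrib)

lemma cinner_scale_right: "cinner x (c *s y) = c * cinner x y"
  by (simp add: cinner_def sum_distrib_left mult_ac)

lemma cinner_zero_right [simp]: "cinner x 0 = 0"
  by (simp add: cinner_def)

lemma cnj_cinner: "cnj (cinner x y) = cinner y x"
  by (simp add: cinner_def mult_ac)

lemma Re_cinner: "Re (cinner x y) = x \<bullet> y"
  by (simp add: cinner_def inner_vec_def inner_complex_def)

lemma cinner_self_eq_0: "cinner x x = 0 \<Longrightarrow> x = 0"
  using Re_cinner[of x x] by simp

lemma mat_mult_vec: "mat c *v y = c *s y" for y :: "complex^'n"
proof -
  have "(mat c *v y) $ i = (\<Sum>j\<in>UNIV. if i = j then c * y $ j else 0)" for i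
    unfolding matrix_vector_mult_def mat_def vec_lambda_beta by (rule sum.cong) simp_all
  then show ?thesis by (simp add: vec_eq_iff)
qed

lemma mat_mult_mat: "mat a ** mat b = (mat (a * b) :: complex^'n^'n)"
  by (simp add: matrix_eq mat_mult_vec vector_smult_assoc flip: matrix_vector_mul_assoc)

lemma mat_mult_commute: "A ** mat c = mat c ** A" for A :: "complex^'n^'n"
  by (simp add: matrix_eq mat_mult_vec vector_scalar_commute flip: matrix_vector_mul_assoc)

lemma projective_rep_adj:
  fixes U :: "'g \<Rightarrow> complex^'n^'n"
  assumes "group G" "projective_rep G T U" "g \<in> carrier G"
  obtains c where "adj (U g) = mat c ** U (inv\<^bsub>G\<^esub> g)"
proof -
  interpret group G by fact
  obtain \<omega> where uni: "\<And>g. g \<in> carrier G \<Longrightarrow> unitary (U g)"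
    and \<omega>: "\<And>g h. g \<in> carrier G \<Longrightarrow> h \<in> carrier G \<Longrightarrow>
       cmod (\<omega> g h) = 1 \<and> U g ** U h = mat (\<omega> g h) ** U (g \<otimes>\<^bsub>G\<^esub> h)"
    using assms(2) unfolding projective_rep_def by blast
  have one: "U \<one>\<^bsub>G\<^esub> = mat (\<omega> \<one>\<^bsub>G\<^esub> \<one>\<^bsub>G\<^esub>)"
  proof -
    have "U \<one>\<^bsub>G\<^esub> ** U \<one>\<^bsub>G\<^esub> = mat (\<omega> \<one>\<^bsub>G\<^esub> \<one>\<^bsub>G\<^esub>) ** U \<one>\<^bsub>G\<^esub>"
      using \<omega>[of "\<one>\<^bsub>G\<^esub>" "\<one>\<^bsub>G\<^esub>"] by simp
    then have "(U \<one>\<^bsub>G\<^esub> ** U \<one>\<^bsub>G\<^esub>) ** adj (U \<one>\<^bsub>G\<^esub>) =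
        (mat (\<omega> \<one>\<^bsub>G\<^esub> \<one>\<^bsub>G\<^esub>) ** U \<one>\<^bsub>G\<^esub>) ** adj (U \<one>\<^bsub>G\<^esub>)"
      by simp
    moreover have "U \<one>\<^bsub>G\<^esub> ** adj (U \<one>\<^bsub>G\<^esub>) = mat 1"
      using uni[of "\<one>\<^bsub>G\<^esub>"] by (simp add: unitary_def)
    ultimately show ?thesis
      by (simp add: matrix_mul_assoc[symmetric])
  qed
  define c where "c = \<omega> g (inv\<^bsub>G\<^esub> g) * \<omega> \<one>\<^bsub>G\<^esub> \<one>\<^bsub>G\<^esub>"
  have "cmod c = 1"
    using \<omega>[of g "inv\<^bsub>G\<^esub> g"] \<omega>[of "\<one>\<^bsub>G\<^esub>" "\<one>\<^bsub>G\<^esub>"] assms(3) by (simp add: c_def norm_mult)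
  then have "c \<noteq> 0" by auto
  have ug: "U g ** U (inv\<^bsub>G\<^esub> g) = mat c"
    using \<omega>[of g "inv\<^bsub>G\<^esub> g"] assms(3) one by (simp add: c_def mat_mult_mat)
  have "adj (U g) ** U g = mat 1"
    using uni[OF assms(3)] by (simp add: unitary_def)
  then have "U (inv\<^bsub>G\<^esub> g) = adj (U g) ** mat c"
    by (metis ug matrix_mul_assoc matrix_mul_lid)
  moreover have "adj (U g) ** mat c = mat c ** adj (U g)"
    by (rule mat_mult_commute)
  ultimately have "mat (inverse c) ** U (inv\<^bsub>G\<^esub> g) = (mat (inverse c) ** mat c) ** adj (U g)"
    by (simp add: matrix_mul_assoc)
  also have "\<dots> = adj (U g)"
    using \<open>c \<noteq> 0\<close> by (simp add: mat_mult_mat)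
  finally show thesis using that by metis
qed

theorem irrep_decomposition_exists:
  fixes U :: "'g \<Rightarrow> complex^'n^'n"
  assumes "group G" "projective_rep G T U"
  shows "\<exists>D. irrep_decomposition G U D"
proof -
  interpret group G by fact
  define good where "good D \<longleftrightarrow> finite D \<and> (\<forall>W\<in>D. irreducible_subspace G U W) \<and>
     (\<forall>V\<in>D. \<forall>W\<in>D. V \<noteq> W \<longrightarrow> (\<forall>v\<in>V. \<forall>w\<in>W. cinner v w = 0))" for D
  have bound: "card D \<le> DIM(complex^'n)" if "good D" for D
  proof -
    have nz: "\<exists>w. w \<in> W \<and> w \<noteq> 0" if "W \<in> D" for W
    proof -
      have "irreducible_subspace G U W" using \<open>good D\<close> that by (auto simp: good_def)
      then have "0 \<in> W" "W \<noteq> {0}"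
        unfolding irreducible_subspace_def invariant_subspace_def by (auto intro: vec.subspace_0)
      then show ?thesis by auto
    qed
    then obtain f where f: "\<And>W. W \<in> D \<Longrightarrow> f W \<in> W \<and> f W \<noteq> 0" by metis
    have orth: "f V \<bullet> f W = 0" if "V \<in> D" "W \<in> D" "V \<noteq> W" for V W
    proof -
      have "cinner (f V) (f W) = 0"
        using \<open>good D\<close> that f unfolding good_def by blast
      then show ?thesis by (metis Re_cinner zero_complex.sel(1))
    qed
    have inj: "inj_on f D"
      by (rule inj_onI) (metis orth f inner_eq_zero_iff)
    have "pairwise orthogonal (f ` D)" "0 \<notin> f ` D"
      using orth f by (auto simp: pairwise_def orthogonal_def)
    then have "independent (f ` D)"
      by (rule pairwise_orthogonal_independent)
    then have "card (f ` D) \<le> DIM(complex^'n)"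
      using independent_bound by blast
    then show ?thesis using card_image[OF inj] by simp
  qed
  have "good {}" by (simp add: good_def)
  moreover have "\<forall>D. good D \<longrightarrow> card D < DIM(complex^'n) + 1"
    using bound by (simp add: less_Suc_eq_le)
  ultimately obtain D where D: "good D" and maxD: "\<And>D'. good D' \<Longrightarrow> card D' \<le> card D"
    using Lattices_Big.ex_has_greatest_nat[of good "{}" card "DIM(complex^'n) + 1"] by blast
  define K where "K = {x. \<forall>W\<in>D. \<forall>w\<in>W. cinner w x = 0}"
  have Kinv: "invariant_subspace G U K"
    unfolding invariant_subspace_def
  proof (intro conjI ballI)
    show "vec.subspace K"
      by (rule vec.subspaceI) (auto simp: K_def cinner_add_right cinner_scale_right)
    fix g x assume g: "g \<in> carrier G" and x: "x \<in> K"
    obtain c where c: "adj (U g) = mat c ** U (inv\<^bsub>G\<^esub> g)"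
      using projective_rep_adj[OF assms g] by blast
    have "cinner w (U g *v x) = 0" if "W \<in> D" "w \<in> W" for W w
    proof -
      have W: "vec.subspace W" "\<forall>g\<in>carrier G. \<forall>w\<in>W. U g *v w \<in> W"
        using D that(1) by (auto simp: good_def irreducible_subspace_def invariant_subspace_def)
      have "adj (U g) *v w = c *s (U (inv\<^bsub>G\<^esub> g) *v w)"
        by (simp add: c mat_mult_vec flip: matrix_vector_mul_assoc)
      then have "adj (U g) *v w \<in> W"
        using W g that(2) by (simp add: vec.subspace_scale)
      then show ?thesis
        using x that(1) by (auto simp: K_def cinner_adj)
    qed
    then show "U g *v x \<in> K" by (auto simp: K_def)
  qed
  have K0: "K = {0}"
  proof (rule ccontr)
    assume "K \<noteq> {0}"
    then have "invariant_subspace G U K \<and> K \<noteq> {0} \<and> K \<subseteq> K" using Kinv by simp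
    from ex_has_least_nat[of "\<lambda>V. invariant_subspace G U V \<and> V \<noteq> {0} \<and> V \<subseteq> K", OF this, of vec.dim]
    obtain W where W: "invariant_subspace G U W \<and> W \<noteq> {0} \<and> W \<subseteq> K"
      and minW: "\<And>V. invariant_subspace G U V \<and> V \<noteq> {0} \<and> V \<subseteq> K \<Longrightarrow> vec.dim W \<le> vec.dim V"
      by blast
    have irrW: "irreducible_subspace G U W"
      unfolding irreducible_subspace_def
    proof (intro conjI allI impI)
      fix V assume V: "invariant_subspace G U V \<and> V \<subseteq> W"
      show "V = {0} \<or> V = W"
      proof (rule disjCI)
        assume "V \<noteq> W"
        show "V = {0}"
        proof (rule ccontr)
          assume "V \<noteq> {0}"
          then have "vec.dim W \<le> vec.dim V" using minW V W by blast
          then have "V = W"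
            using V W unfolding invariant_subspace_def by (metis vec.subspace_dim_equal)
          then show False using \<open>V \<noteq> W\<close> by simp
        qed
      qed
    qed (use W in auto)
    have orthW: "cinner v w = 0" "cinner w v = 0" if "V \<in> D" "v \<in> V" "w \<in> W" for V v w
    proof -
      show "cinner v w = 0" using W that by (auto simp: K_def)
      then show "cinner w v = 0" by (metis cnj_cinner complex_cnj_zero)
    qed
    have "good (insert W D)"
      unfolding good_def
    proof (intro conjI ballI impI)
      fix V V' v w assume *: "V \<in> insert W D" "V' \<in> insert W D" "V \<noteq> V'" "v \<in> V" "w \<in> V'"
      consider "V \<in> D" "V' \<in> D" | "V = W" "V' \<in> D" | "V \<in> D" "V' = W" using * by blast
      then show "cinner v w = 0"
      proof cases
        case 1
        then show ?thesis using D * unfolding good_def by blast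
      qed (use orthW * in auto)
    qed (use D irrW in \<open>auto simp: good_def\<close>)
    moreover have "W \<notin> D"
    proof
      assume "W \<in> D"
      then have "\<forall>w\<in>W. w = 0" using orthW cinner_self_eq_0 by blast
      moreover have "0 \<in> W" using W by (auto simp: invariant_subspace_def vec.subspace_0)
      ultimately show False using W by auto
    qed
    ultimately show False using maxD[of "insert W D"] D by (simp add: good_def)
  qed
  have "vec.span (\<Union>D) = UNIV"
  proof (rule ccontr)
    let ?S = "vec.span (\<Union>D)"
    assume "?S \<noteq> UNIV"
    have real: "subspace ?S"
    proof (rule subspaceI)
      fix c :: real and x assume "x \<in> ?S"
      then have "of_real c *s x \<in> ?S" by (rule vec.span_scale)
      moreover have "of_real c *s x = c *\<^sub>R x"
        by (simp add: vec_eq_iff scaleR_conv_of_real[where 'a = complex])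
      ultimately show "c *\<^sub>R x \<in> ?S" by simp
    qed (auto intro: vec.span_zero vec.span_add)
    then have "span ?S = ?S" by (rule span_eq_iff[THEN iffD2])
    then have "span ?S \<subset> span UNIV"
      using \<open>?S \<noteq> UNIV\<close> by (metis psubsetI span_UNIV subset_UNIV)
    then obtain x where x: "x \<noteq> 0" "x \<in> span UNIV" "\<And>y. y \<in> span ?S \<Longrightarrow> orthogonal x y"
      using orthogonal_to_subspace_exists_gen[of ?S UNIV] by metis
    have perp: "Re (cinner x y) = 0" if "y \<in> ?S" for y
      using x(3)[OF span_base[OF that]] by (simp add: Re_cinner orthogonal_def)
    have "cinner w x = 0" if "W \<in> D" "w \<in> W" for W w
    proof -
      have "w \<in> \<Union>D" using that by blast
      then have w: "w \<in> ?S" by (rule vec.span_base)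
      then have "\<i> *s w \<in> ?S" by (rule vec.span_scale)
      from perp[OF w] perp[OF this] have "cinner x w = 0"
        by (simp add: cinner_scale_right complex_eq_iff)
      then show ?thesis by (metis cnj_cinner complex_cnj_zero)
    qed
    then have "x \<in> K" by (simp add: K_def)
    then show False using K0 x(1) by simp
  qed
  then have "irrep_decomposition G U D"
    using D unfolding irrep_decomposition_def good_def by (intro conjI) simp_all
  then show ?thesis ..
qed

end

theory Submission
  imports Defs "HOL-Computational_Algebra.Fundamental_Theorem_Algebra"
begin

text \<open>Twirling by the Haar measure sends the tuples \<open>(X\<^sub>i\<^sup>\<dagger> N\<^sub>i X\<^sub>i)\<^sub>i\<close> linearly into the commutant of
  the representation. These tuples form a space of dimension \<open>\<Sum> r\<^sub>i\<^sup>2\<close>, whereas by Schur's lemma the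
  commutant has dimension at most \<open>\<Sum> m\<^sub>\<mu>\<^sup>2\<close>. If the former exceeds the latter, some nonzero tuple, which
  can be taken Hermitian, is annihilated by summing the twirls, and adding and subtracting a small
  multiple of it exhibits \<open>A\<close> as a midpoint of two other points of the convex set.\<close>

section \<open>Linear algebra\<close>

text \<open>When \<open>X i\<close> is singular, the map from \<open>N i\<close> to
  \<open>adj (X i) ** N i ** X i\<close> is not injective on all matrices, so coordinates must be
  chosen before dimensions can be counted. Let \<open>J i\<close> index rows of \<open>X i\<close>
  that form a basis of its row space. For \<open>N i\<close> supported on the square of
  \<open>J i\<close> the map is injective, and exactly (rank \<open>X i\<close>)^2 entries are free.
  The count is over the complex numbers, while convexity only admits Hermitian directions. The twirl
  commutes with adjoints, so the space of solutions is closed under taking adjoints and contains a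
  nonzero Hermitian element. An arbitrary Hermitian perturbation could destroy positivity wherever a
  block of \<open>A\<close> is singular. The sandwich form prevents this: at a vector x both the
  block and its perturbation depend only on y = \<open>X i *v x\<close>, and the squared norm of y
  dominates a small multiple of the perturbation.\<close>

lemma (in vector_space) linear_relation_if_card_less:
  fixes f :: "'i \<Rightarrow> 'b"
  assumes "finite S" "finite F" "card F < card S" "f ` S \<subseteq> span F"
  shows "\<exists>c. (\<exists>s\<in>S. c s \<noteq> 0) \<and> (\<Sum>s\<in>S. scale (c s) (f s)) = 0"
proof (cases "inj_on f S")
  case True
  then have "dependent (f ` S)"
    using independent_span_bound[OF assms(2) _ assms(4)] assms(3) by (auto simp: card_image)
  then obtain u where u: "\<exists>v\<in>f ` S. u v \<noteq> 0" "(\<Sum>v\<in>f ` S. scale (u v) v) = 0"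
    using dependent_finite[of "f ` S"] assms(1) by auto
  with True show ?thesis
    by (intro exI[of _ "u \<circ> f"]) (auto simp: sum.reindex)
next
  case False
  then obtain a b where ab: "a \<in> S" "b \<in> S" "a \<noteq> b" "f a = f b"
    by (auto simp: inj_on_def)
  \<comment> \<open>Two indices carrying the same vector already give a relation, with weights 1 and
    -1; this is why the lemma speaks of families and not of sets.\<close>
  define c :: "'i \<Rightarrow> 'a" where "c s = (if s = a then 1 else if s = b then - 1 else 0)" for s
  have "(\<Sum>s\<in>S. scale (c s) (f s)) = (\<Sum>s\<in>{a, b}. scale (c s) (f s))"
    using ab assms(1) by (intro sum.mono_neutral_right) (auto simp: c_def)
  also have "\<dots> = 0" using ab by (simp add: c_def)
  finally show ?thesis using ab by (intro exI[of _ c]) (auto simp: c_def)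
qed

text \<open>One index is picked for each vector of a basis taken from the image, so that
  independence can be expressed by coefficients attached to indices.\<close>

lemma (in vector_space) finite_independent_indices:
  fixes f :: "'i \<Rightarrow> 'b"
  assumes "finite I"
  obtains J where "J \<subseteq> I" "card J = dim (f ` I)"
    "\<And>c. (\<Sum>j\<in>J. scale (c j) (f j)) = 0 \<Longrightarrow> \<forall>j\<in>J. c j = 0"
proof -
  obtain B where B: "B \<subseteq> f ` I" "independent B" "card B = dim (f ` I)"
    using basis_exists by metis
  obtain J where J: "J \<subseteq> I" "inj_on f J" "B = f ` J"
    using B(1) by (meson subset_image_inj)
  have "\<forall>j\<in>J. c j = 0" if c: "(\<Sum>j\<in>J. scale (c j) (f j)) = 0" for c
  proof -
    have "(\<Sum>v\<in>B. scale (c (the_inv_into J f v)) v) = 0"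
      using J c by (simp add: sum.reindex the_inv_into_f_f)
    then have "\<forall>v\<in>B. c (the_inv_into J f v) = 0"
      using B(2) J assms dependent_finite[of B] by (metis finite_imageI finite_subset)
    then show ?thesis using J by (auto simp: the_inv_into_f_f)
  qed
  then show thesis using that[of J] J B card_image by metis
qed

text \<open>The type class structure on matrices only offers real scalars. Complex scaling is
  therefore multiplication by \<open>mat c\<close>, which makes dimension counts over the complex
  numbers available.\<close>

lemma vector_space_matrix: "vector_space (\<lambda>c (A::complex^'n^'m). mat c ** A)"
proof
  fix a b :: complex and A B :: "complex^'n^'m"
  show "mat a ** (A + B) = mat a ** A + mat a ** B"
    by (rule matrix_add_ldistrib)
  show "mat (a + b) ** A = mat a ** A + mat b ** A"
    by (simp add: matrix_eq mat_mult_vec matrix_vector_mult_add_rdistrib vec.scale_left_distrib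
        flip: matrix_vector_mul_assoc)
  show "mat a ** (mat b ** A) = mat (a * b) ** A"
    by (simp add: matrix_mul_assoc mat_mult_mat)
qed simp

lemma mat_mult_component [simp]: "(mat c ** A) $ i $ j = c * A $ i $ j"
  for A :: "complex^'n^'m"
  by (simp add: matrix_matrix_mult_def mat_def if_distrib[of "\<lambda>x. x * _"] cong: if_cong)

lemma adj_mult: "adj (A ** B) = adj B ** adj A"
  by (simp add: adj_def matrix_matrix_mult_def transpose_def map_matrix_def vec_eq_iff mult.commute)

lemma adj_adj [simp]: "adj (adj A) = A"
  by (simp add: adj_def transpose_def map_matrix_def vec_eq_iff)

lemma adj_add: "adj (A + B) = adj A + adj B"
  by (simp add: adj_def transpose_def map_matrix_def vec_eq_iff)

lemma adj_zero [simp]: "adj 0 = 0"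
  by (simp add: adj_def transpose_def map_matrix_def vec_eq_iff)

lemma adj_mat: "adj (mat c) = mat (cnj c)"
  by (auto simp: adj_def transpose_def map_matrix_def vec_eq_iff mat_def)

lemma adj_component: "adj A $ i $ j = cnj (A $ j $ i)"
  by (simp add: adj_def transpose_def map_matrix_def)

lemma bounded_linear_adj: "bounded_linear (adj :: complex^'n^'m \<Rightarrow> complex^'m^'n)"
  unfolding linear_conv_bounded_linear[symmetric]
  by (rule linearI) (simp_all add: vec_eq_iff adj_component)

text \<open>This moves fixed left and right factors through the Bochner integral.\<close>

lemma bounded_linear_sandwich:
  fixes P Q :: "complex^'n^'n"
  shows "bounded_linear (\<lambda>B. P ** B ** Q)"
  unfolding linear_conv_bounded_linear[symmetric]
  by (rule linearI)
    (simp_all add: vec_eq_iff matrix_matrix_mult_def sum_distrib_left sum_distrib_right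
      algebra_simps sum.distrib scaleR_sum_right)

text \<open>\<open>J\<close> indexes a basis of the row space chosen among the rows. If y is
  supported on \<open>J\<close> and killed by \<open>adj X\<close>, then the conjugates of its
  entries are the coefficients of a linear relation among these rows, hence all zero.\<close>

lemma rank_support:
  fixes X :: "complex^'n^'m"
  obtains J where "card J = rank X"
    "\<And>y. adj X *v y = 0 \<Longrightarrow> \<forall>j. j \<notin> J \<longrightarrow> y $ j = 0 \<Longrightarrow> y = 0"
proof -
  obtain J where J: "card J = vec.dim (range (\<lambda>j. X $ j))"
    and indep: "\<And>c. (\<Sum>j\<in>J. c j *s X $ j) = 0 \<Longrightarrow> \<forall>j\<in>J. c j = 0"
    using vec.finite_independent_indices[OF finite, where f = "\<lambda>j. X $ j" and I = UNIV] by metis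
  have "rows X = range (\<lambda>j. X $ j)" by (auto simp: rows_def row_def)
  then have "card J = rank X" by (simp add: J row_rank_def_gen)
  moreover have "y = 0" if y: "adj X *v y = 0" and supp: "\<forall>j. j \<notin> J \<longrightarrow> y $ j = 0" for y
  proof -
    have "(\<Sum>j\<in>J. cnj (y $ j) *s X $ j) $ i = 0" for i
    proof -
      have "(\<Sum>j\<in>J. cnj (y $ j) *s X $ j) $ i = (\<Sum>j\<in>J. cnj (y $ j) * X $ j $ i)"
        by simp
      also have "\<dots> = (\<Sum>j\<in>UNIV. cnj (y $ j) * X $ j $ i)"
        by (rule sum.mono_neutral_left) (auto simp: supp)
      also have "\<dots> = cnj ((adj X *v y) $ i)"
        by (simp add: matrix_vector_mult_def adj_component mult.commute)
      finally show ?thesis by (simp add: y)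
    qed
    then have "\<forall>j\<in>J. cnj (y $ j) = 0" by (intro indep) (simp add: vec_eq_iff)
    then show ?thesis using supp by (auto simp: vec_eq_iff)
  qed
  ultimately show thesis using that by blast
qed

text \<open>Take a nonzero polynomial \<open>p\<close> of minimal degree with \<open>p(S) v = 0\<close> and split off a root.\<close>

lemma ex_eigenvector_in_subspace:
  fixes S :: "complex^'n^'n"
  assumes "vec.subspace V" "V \<noteq> {0}" and inv: "\<And>v. v \<in> V \<Longrightarrow> S *v v \<in> V"
  obtains k w where "w \<in> V" "w \<noteq> 0" "S *v w = k *s w"
proof -
  have "0 \<in> V" using assms(1) by (rule vec.subspace_0)
  with assms(2) obtain v where v: "v \<in> V" "v \<noteq> 0" by auto
  define s where "s i = ((*v) S ^^ i) v" for i
  have sV: "s i \<in> V" for i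
    by (induction i) (simp_all add: s_def v inv)
  \<comment> \<open>This is p(S) v, since \<open>s i\<close> is the i-th power of \<open>S\<close>
    applied to v.\<close>
  define E where "E p = (\<Sum>i\<le>degree p. coeff p i *s s i)" for p
  have E_alt: "E p = (\<Sum>i\<le>n. coeff p i *s s i)" if "degree p \<le> n" for p n
    unfolding E_def using that by (intro sum.mono_neutral_left) (auto simp: coeff_eq_0)
  have EV: "E p \<in> V" for p
    unfolding E_def using sV assms(1) by (intro vec.subspace_sum vec.subspace_scale)
  have E_pCons0: "E (pCons 0 p) = S *v E p" for p
  proof -
    have "E (pCons 0 p) = (\<Sum>i\<le>Suc (degree p). coeff (pCons 0 p) i *s s i)"
      by (rule E_alt) (rule degree_pCons_le)
    also have "\<dots> = (\<Sum>i\<le>degree p. coeff p i *s s (Suc i))"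
      by (subst sum.atMost_Suc_shift) simp
    also have "\<dots> = S *v E p"
      by (simp add: E_def s_def vec.linear_sum[OF matrix_vector_mul_linear_gen] vec.scale
          vec.linear_scale[OF matrix_vector_mul_linear_gen])
    finally show ?thesis .
  qed
  have E_diff: "E (p - smult c q) = E p - c *s E q" for p q c
  proof -
    let ?n = "max (degree p) (degree q)"
    have "E (p - smult c q) = (\<Sum>i\<le>?n. coeff (p - smult c q) i *s s i)"
      by (intro E_alt degree_diff_le) auto
    also have "\<dots> = (\<Sum>i\<le>?n. coeff p i *s s i) - c *s (\<Sum>i\<le>?n. coeff q i *s s i)"
      by (simp add: vec.scale_left_diff_distrib sum_subtractf vec.scale_sum_right)
    finally show ?thesis using E_alt[of p ?n] E_alt[of q ?n] by simp
  qed
  have "\<exists>p. p \<noteq> 0 \<and> E p = 0"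
  proof -
    \<comment> \<open>The index set runs from 0 to \<open>CARD('n)\<close> inclusive, one element
      more than the standard basis.\<close>
    have "\<exists>c. (\<exists>i\<in>{..CARD('n)}. c i \<noteq> 0) \<and> (\<Sum>i\<in>{..CARD('n)}. c i *s s i) = 0"
    proof (rule vec.linear_relation_if_card_less)
      show "card (cart_basis :: (complex^'n) set) < card {..CARD('n)}"
        by (simp add: card_cart_basis)
    qed (auto simp: finite_cart_basis)
    then obtain c i where c: "i \<le> CARD('n)" "c i \<noteq> 0" "(\<Sum>i\<le>CARD('n). c i *s s i) = 0"
      by auto
    define p where "p = (\<Sum>i\<le>CARD('n). monom (c i) i)"
    have cp: "coeff p i = (if i \<le> CARD('n) then c i else 0)" for i
      by (simp add: p_def coeff_sum)
    then have "degree p \<le> CARD('n)" by (intro degree_le) auto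
    then have "E p = 0" using c(3) by (simp add: E_alt cp)
    moreover have "p \<noteq> 0" using cp[of i] c by auto
    ultimately show ?thesis by blast
  qed
  then obtain p where p: "p \<noteq> 0" "E p = 0"
    and least: "\<And>q. q \<noteq> 0 \<Longrightarrow> E q = 0 \<Longrightarrow> degree p \<le> degree q"
    using ex_has_least_nat[of "\<lambda>p. p \<noteq> 0 \<and> E p = 0" _ degree] by blast
  \<comment> \<open>A nonzero constant polynomial would send the nonzero vector v to a nonzero
    multiple of itself.\<close>
  have "degree p \<noteq> 0"
  proof
    assume "degree p = 0"
    then obtain a where "p = [:a:]" by (rule degree_eq_zeroE)
    then show False using p v by (simp add: E_def s_def)
  qed
  then obtain k where "poly p k = 0"
    using fundamental_theorem_of_algebra_alt[of p] by (metis degree_pCons_0 )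
  then obtain q where q: "p = [:- k, 1:] * q" by (auto simp: poly_eq_0_iff_dvd)
  \<comment> \<open>Minimality of the degree gives q(S) v \<noteq> 0, while (S - k) q(S) v = p(S) v
    = 0; so q(S) v is the eigenvector.\<close>
  have "q \<noteq> 0" using p q by auto
  moreover from this have "degree p = degree [:- k, 1:] + degree q"
    unfolding q by (intro degree_mult_eq) auto
  then have "degree q < degree p" by simp
  ultimately have "E q \<noteq> 0" using least[of q] by auto
  moreover have "p = pCons 0 q - smult k q" by (simp add: q)
  then have "S *v E q = k *s E q" using p(2) by (simp add: E_diff E_pCons0)
  ultimately show thesis using EV that by blast
qed


section \<open>The commutant\<close>

definition commutant ::
    "('g, 'm) monoid_scheme \<Rightarrow> ('g \<Rightarrow> complex^'n^'n) \<Rightarrow> (complex^'n^'n) set" where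
  "commutant G U = {Y. \<forall>g\<in>carrier G. U g ** Y = Y ** U g}"

section \<open>Projections onto the summands of a decomposition\<close>

lemma cinner_zero_left [simp]: "cinner 0 x = 0"
  by (simp add: cinner_def)

lemma cinner_sum_right: "cinner x (\<Sum>i\<in>I. f i) = (\<Sum>i\<in>I. cinner x (f i))"
  by (induction I rule: infinite_finite_induct) (simp_all add: cinner_add_right)

lemma matrix_vector_mult_sum_left: "(\<Sum>i\<in>I. F i) *v x = (\<Sum>i\<in>I. F i *v x)"
  for F :: "_ \<Rightarrow> complex^'n^'m"
  by (induction I rule: infinite_finite_induct)
    (simp_all add: matrix_vector_mult_add_rdistrib)

text \<open>The differences of the components sum to 0. Pairing this sum with the difference that
  lies in \<open>V\<close> leaves only the squared norm of that difference.\<close>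

lemma orthogonal_sum_unique:
  assumes "finite D" and sub: "\<And>W. W \<in> D \<Longrightarrow> vec.subspace W"
    and orth: "\<And>V W v w. V \<in> D \<Longrightarrow> W \<in> D \<Longrightarrow> V \<noteq> W \<Longrightarrow> v \<in> V \<Longrightarrow> w \<in> W \<Longrightarrow> cinner v w = 0"
    and f: "\<And>W. W \<in> D \<Longrightarrow> f W \<in> W" and h: "\<And>W. W \<in> D \<Longrightarrow> h W \<in> W"
    and eq: "(\<Sum>W\<in>D. f W) = (\<Sum>W\<in>D. h W)" and "V \<in> D"
  shows "f V = h V"
proof -
  define d where "d W = f W - h W" for W
  have d: "d W \<in> W" if "W \<in> D" for W
    unfolding d_def using that by (intro vec.subspace_diff sub f h)
  have "0 = cinner (d V) (\<Sum>W\<in>D. d W)"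
    by (simp add: d_def sum_subtractf eq)
  also have "\<dots> = (\<Sum>W\<in>D. if W = V then cinner (d V) (d V) else 0)"
    unfolding cinner_sum_right using orth d \<open>V \<in> D\<close> by (intro sum.cong) auto
  also have "\<dots> = cinner (d V) (d V)"
    using assms(1) \<open>V \<in> D\<close> by simp
  finally have "d V = 0" using cinner_self_eq_0 by metis
  then show ?thesis by (simp add: d_def)
qed

text \<open>Components of a vector exist because the summands span, and they are unique by
  orthogonality. Uniqueness yields the rest: sums and multiples of components are again components,
  which is linearity, and applying \<open>U g\<close> to the components of x gives those of
  \<open>U g *v x\<close>, which is membership in the commutant.\<close>

lemma irrep_decomposition_projections:
  fixes U :: "'g \<Rightarrow> complex^'n^'n"
  assumes D: "irrep_decomposition G U D"
  obtains P :: "(complex^'n) set \<Rightarrow> complex^'n^'n" where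
    "\<And>W x. W \<in> D \<Longrightarrow> P W *v x \<in> W"
    "\<And>x. (\<Sum>W\<in>D. P W *v x) = x"
    "\<And>W. W \<in> D \<Longrightarrow> P W \<in> commutant G U"
proof -
  have fin: "finite D" and span: "vec.span (\<Union>D) = UNIV"
    and sub: "\<And>W. W \<in> D \<Longrightarrow> vec.subspace W"
    and inv: "\<And>W g w. W \<in> D \<Longrightarrow> g \<in> carrier G \<Longrightarrow> w \<in> W \<Longrightarrow> U g *v w \<in> W"
    and orth: "\<And>V W v w. V \<in> D \<Longrightarrow> W \<in> D \<Longrightarrow> V \<noteq> W \<Longrightarrow> v \<in> V \<Longrightarrow> w \<in> W \<Longrightarrow> cinner v w = 0"
    using D unfolding irrep_decomposition_def irreducible_subspace_def invariant_subspace_def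
    by auto
  define decomp where "decomp x f \<longleftrightarrow> (\<forall>W\<in>D. f W \<in> W) \<and> (\<Sum>W\<in>D. f W) = x" for x f
  have unique: "f W = h W" if "decomp x f" "decomp x h" "W \<in> D" for x f h W
    using that unfolding decomp_def
    by (intro orthogonal_sum_unique[where f = f and h = h, OF fin sub orth]) auto
  have add: "decomp (x + y) (\<lambda>W. f W + h W)" if "decomp x f" "decomp y h" for x y f h
    using that sub unfolding decomp_def by (auto simp: sum.distrib vec.subspace_add)
  have scale: "decomp (c *s x) (\<lambda>W. c *s f W)" if "decomp x f" for c x f
    using that sub unfolding decomp_def
    by (auto simp: vec.subspace_scale simp flip: vec.scale_sum_right)
  have ex: "\<exists>f. decomp x f" for x
  proof -
    have "x \<in> vec.span (\<Union>D)" by (simp add: span)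
    then show ?thesis
    proof (rule vec.span_induct)
      show "vec.subspace {x. \<exists>f. decomp x f}"
      proof (rule vec.subspaceI)
        have "decomp 0 (\<lambda>W. 0)"
          using sub by (auto simp: decomp_def vec.subspace_0)
        then show "0 \<in> {x. \<exists>f. decomp x f}" by blast
      qed (use add scale in blast)+
    next
      fix x assume "x \<in> \<Union>D"
      then obtain V where "V \<in> D" "x \<in> V" by blast
      then have "decomp x (\<lambda>W. if W = V then x else 0)"
        using sub fin by (auto simp: decomp_def vec.subspace_0)
      then show "\<exists>f. decomp x f" by blast
    qed
  qed
  then obtain p where p: "\<And>x. decomp x (p x)" by metis
  define P where "P W = matrix (\<lambda>x. p x W)" for W
  have P: "P W *v x = p x W" if "W \<in> D" for W x
  proof -
    have "Vector_Spaces.linear (*s) (*s) (\<lambda>x. p x W)"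
      by (intro Vector_Spaces.linear_iff[THEN iffD2] conjI allI)
        (use unique[OF p add[OF p p]] unique[OF p scale[OF p]] that vec.vector_space_axioms in auto)
    then show ?thesis by (simp add: P_def matrix_works)
  qed
  show thesis
  proof
    show "P W *v x \<in> W" if "W \<in> D" for W x
      using p that by (simp add: P decomp_def)
    show "(\<Sum>W\<in>D. P W *v x) = x" for x
      using p[of x] by (simp add: P decomp_def)
    show "P W \<in> commutant G U" if "W \<in> D" for W
      unfolding commutant_def
    proof (intro CollectI ballI)
      fix g assume g: "g \<in> carrier G"
      have "U g *v p x W = p (U g *v x) W" for x
      proof (rule unique[OF _ p that])
        show "decomp (U g *v x) (\<lambda>W. U g *v p x W)"
          using p[of x] inv g unfolding decomp_def
          by (auto simp flip: vec.linear_sum[OF matrix_vector_mul_linear_gen])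
      qed
      then show "U g ** P W = P W ** U g"
        using that by (simp add: matrix_eq P flip: matrix_vector_mul_assoc)
    qed
  qed
qed

section \<open>Schur's lemma for irreducible subspaces\<close>

lemma schur_zero_or_bij:
  fixes U :: "'g \<Rightarrow> complex^'n^'n"
  assumes V: "irreducible_subspace G U V" and W: "irreducible_subspace G U W"
    and ZW: "\<And>v. v \<in> V \<Longrightarrow> Z *v v \<in> W" and Z: "Z \<in> commutant G U"
  shows "(\<forall>v\<in>V. Z *v v = 0) \<or> bij_betw ((*v) Z) V W"
proof -
  have subV: "vec.subspace V" and invV: "\<And>g v. g \<in> carrier G \<Longrightarrow> v \<in> V \<Longrightarrow> U g *v v \<in> V"
    using V by (auto simp: irreducible_subspace_def invariant_subspace_def)
  have comm: "U g *v (Z *v v) = Z *v (U g *v v)" if "g \<in> carrier G" for g v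
    using Z that by (simp add: commutant_def matrix_vector_mul_assoc)
  \<comment> \<open>Kernel and image of \<open>Z\<close> on \<open>V\<close> are both invariant.
    Irreducibility of \<open>V\<close> and \<open>W\<close> makes each of them trivial or
    everything.\<close>
  let ?K = "{v \<in> V. Z *v v = 0}" and ?I = "(*v) Z ` V"
  have "invariant_subspace G U ?K"
    unfolding invariant_subspace_def
  proof (intro conjI ballI)
    show "vec.subspace ?K"
      using subV by (auto intro!: vec.subspaceI simp: vec.subspace_0 vec.subspace_add
          vec.subspace_scale vec.linear_add[OF matrix_vector_mul_linear_gen]
          vec.linear_scale[OF matrix_vector_mul_linear_gen])
  qed (use invV in \<open>auto simp flip: comm\<close>)
  then have K: "?K = {0} \<or> ?K = V"
    using V unfolding irreducible_subspace_def by blast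
  have "invariant_subspace G U ?I"
    unfolding invariant_subspace_def
  proof (intro conjI ballI)
    show "vec.subspace ?I"
      by (rule vec.linear_subspace_image[OF matrix_vector_mul_linear_gen subV])
  qed (use invV in \<open>auto simp: comm\<close>)
  moreover have "?I \<subseteq> W" using ZW by blast
  ultimately have I: "?I = {0} \<or> ?I = W"
    using W unfolding irreducible_subspace_def by blast
  have "inj_on ((*v) Z) V" if "?K = {0}"
    using that vec.linear_inj_on_iff_eq_0[OF matrix_vector_mul_linear_gen subV, of Z] by blast
  with K I show ?thesis by (auto simp: bij_betw_def)
qed

text \<open>Undoing \<open>R\<close> turns \<open>Z\<close> into an endomorphism of
  \<open>V\<close>, which has an eigenvalue k. The vectors of \<open>V\<close> on which
  \<open>Z\<close> agrees with k times \<open>R\<close> form an invariant subspace containing an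
  eigenvector, so irreducibility makes it all of \<open>V\<close>.\<close>

lemma schur_scalar:
  fixes U :: "'g \<Rightarrow> complex^'n^'n"
  assumes V: "irreducible_subspace G U V"
    and R: "bij_betw ((*v) R) V W"
      "\<And>g v. g \<in> carrier G \<Longrightarrow> v \<in> V \<Longrightarrow> R *v (U g *v v) = U g *v (R *v v)"
    and ZW: "\<And>v. v \<in> V \<Longrightarrow> Z *v v \<in> W" and Z: "Z \<in> commutant G U"
  shows "\<exists>c. \<forall>v\<in>V. Z *v v = c *s (R *v v)"
proof -
  have subV: "vec.subspace V" and invV: "\<And>g v. g \<in> carrier G \<Longrightarrow> v \<in> V \<Longrightarrow> U g *v v \<in> V"
    and "V \<noteq> {0}"
    using V by (auto simp: irreducible_subspace_def invariant_subspace_def)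
  have comm: "U g *v (Z *v v) = Z *v (U g *v v)" if "g \<in> carrier G" for g v
    using Z that by (simp add: commutant_def matrix_vector_mul_assoc)
  obtain h where h: "Vector_Spaces.linear (*s) (*s) h" "\<And>v. v \<in> V \<Longrightarrow> h (R *v v) = v"
    using vec.linear_exists_left_inverse_on[OF matrix_vector_mul_linear_gen subV, of R] R(1)
    by (metis bij_betw_imp_inj_on)
  \<comment> \<open>On \<open>V\<close> this is the inverse of \<open>R\<close> after
    \<open>Z\<close>; it is assembled from a global left inverse so that it is a matrix.\<close>
  define S where "S = matrix h ** Z"
  have S: "S *v v \<in> V \<and> R *v (S *v v) = Z *v v" if v: "v \<in> V" for v
  proof -
    obtain u where u: "u \<in> V" "Z *v v = R *v u"
      using ZW[OF v] R(1) by (auto simp: bij_betw_def)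
    then have "S *v v = u"
      by (simp add: S_def matrix_works h flip: matrix_vector_mul_assoc)
    with u show ?thesis by simp
  qed
  obtain k w where w: "w \<in> V" "w \<noteq> 0" "S *v w = k *s w"
    using ex_eigenvector_in_subspace[OF subV \<open>V \<noteq> {0}\<close>] S by metis
  let ?K = "{v \<in> V. Z *v v = k *s (R *v v)}"
  have "invariant_subspace G U ?K"
    unfolding invariant_subspace_def
  proof (intro conjI ballI)
    show "vec.subspace ?K"
      using subV by (auto intro!: vec.subspaceI simp: vec.subspace_0 vec.subspace_add
          vec.subspace_scale vec.linear_add[OF matrix_vector_mul_linear_gen]
          vec.linear_scale[OF matrix_vector_mul_linear_gen] vec.scale_right_distrib
          vec.scale_left_commute)
  qed (use invV in \<open>auto simp: R(2) vec.linear_scale[OF matrix_vector_mul_linear_gen] simp flip: comm\<close>)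
  then have "?K = {0} \<or> ?K = V"
    using V unfolding irreducible_subspace_def by blast
  moreover have "w \<in> ?K"
    using S[OF w(1)] w by (metis (mono_tags, lifting) mem_Collect_eq vec.linear_scale[OF matrix_vector_mul_linear_gen])
  ultimately show ?thesis using w(2) by blast
qed

section \<open>Counting pairs of equivalent summands\<close>

lemma equiv_equivalent_subreps:
  fixes U :: "'g \<Rightarrow> complex^'n^'n"
  assumes inv: "\<And>V. V \<in> D \<Longrightarrow> invariant_subspace G U V"
  shows "equiv D {(V, W). V \<in> D \<and> W \<in> D \<and> equivalent_subreps G U V W}" (is "equiv D ?r")
proof (rule equivI)
  show "refl_on D ?r"
  proof (rule refl_onI)
    show "(V, V) \<in> ?r" if "V \<in> D" for V
      using that unfolding equivalent_subreps_def
      by (auto intro!: exI[of _ "mat 1"] simp: bij_betw_def inj_on_def)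
  qed
  show "sym ?r"
  proof (rule symI, clarsimp)
    fix V W assume VW: "V \<in> D" "W \<in> D" "equivalent_subreps G U V W"
    then obtain R where R: "bij_betw ((*v) R) V W"
      "\<And>g v. g \<in> carrier G \<Longrightarrow> v \<in> V \<Longrightarrow> R *v (U g *v v) = U g *v (R *v v)"
      unfolding equivalent_subreps_def by blast
    have subV: "vec.subspace V" and invV: "\<And>g v. g \<in> carrier G \<Longrightarrow> v \<in> V \<Longrightarrow> U g *v v \<in> V"
      using inv VW(1) by (auto simp: invariant_subspace_def)
    \<comment> \<open>An equivalence must be given by a matrix on the whole space, so the inverse of
      \<open>R\<close>, defined on \<open>W\<close> alone, is extended linearly.\<close>
    obtain h where h: "Vector_Spaces.linear (*s) (*s) h" "\<And>v. v \<in> V \<Longrightarrow> h (R *v v) = v"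
      using vec.linear_exists_left_inverse_on[OF matrix_vector_mul_linear_gen subV, of R] R(1)
      by (metis bij_betw_imp_inj_on)
    have hR: "matrix h *v (R *v v) = v" if "v \<in> V" for v
      using h that by (simp add: matrix_works)
    have RV: "W = (*v) R ` V" using R(1) by (auto simp: bij_betw_def)
    show "equivalent_subreps G U W V"
      unfolding equivalent_subreps_def
    proof (intro exI[of _ "matrix h"] conjI ballI)
      show "bij_betw ((*v) (matrix h)) W V"
        by (rule bij_betwI[where g = "(*v) R"]) (use hR in \<open>auto simp: RV\<close>)
      fix g w assume g: "g \<in> carrier G" and "w \<in> W"
      then obtain v where v: "v \<in> V" "w = R *v v" using RV by blast
      show "matrix h *v (U g *v w) = U g *v (matrix h *v w)"
        using v g by (simp add: hR invV flip: R(2))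
    qed
  qed
  show "trans ?r"
  proof (rule transI, clarsimp)
    fix V W W' assume "equivalent_subreps G U V W" "equivalent_subreps G U W W'"
    then obtain R S where R: "bij_betw ((*v) R) V W"
      "\<And>g v. g \<in> carrier G \<Longrightarrow> v \<in> V \<Longrightarrow> R *v (U g *v v) = U g *v (R *v v)"
      and S: "bij_betw ((*v) S) W W'"
      "\<And>g v. g \<in> carrier G \<Longrightarrow> v \<in> W \<Longrightarrow> S *v (U g *v v) = U g *v (S *v v)"
      unfolding equivalent_subreps_def by blast
    have "bij_betw ((*v) (S ** R)) V W'"
      using bij_betw_trans[OF R(1) S(1)] by (simp add: o_def matrix_vector_mul_assoc)
    moreover have "R *v v \<in> W" if "v \<in> V" for v
      using R(1) that by (auto simp: bij_betw_def)
    ultimately show "equivalent_subreps G U V W'"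
      unfolding equivalent_subreps_def
      by (intro exI[of _ "S ** R"]) (simp add: R(2) S(2) flip: matrix_vector_mul_assoc)
  qed
qed auto

text \<open>An equivalence relation is the disjoint union of the squares of its classes.\<close>

lemma card_equiv_eq_sum_squares:
  assumes "finite D" "equiv D r"
  shows "card r = (\<Sum>\<mu>\<in>D // r. (card \<mu>)\<^sup>2)"
proof -
  have "r \<subseteq> D \<times> D" using assms(2) by (auto simp: equiv_def)
  have "r = (\<Union>\<mu>\<in>D // r. \<mu> \<times> \<mu>)"
  proof (intro equalityI subsetI)
    fix z assume "z \<in> r"
    then obtain x y where z: "z = (x, y)" "(x, y) \<in> r" "x \<in> D"
      using \<open>r \<subseteq> D \<times> D\<close> by (cases z) auto
    then have "x \<in> r `` {x}" "y \<in> r `` {x}" "r `` {x} \<in> D // r"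
      using equiv_class_self[OF assms(2)] by (auto intro: quotientI)
    with z show "z \<in> (\<Union>\<mu>\<in>D // r. \<mu> \<times> \<mu>)" by blast
  next
    fix z assume "z \<in> (\<Union>\<mu>\<in>D // r. \<mu> \<times> \<mu>)"
    then show "z \<in> r" using in_quotient_imp_in_rel[OF assms(2)] by fastforce
  qed
  moreover have "card (\<Union>\<mu>\<in>D // r. \<mu> \<times> \<mu>) = (\<Sum>\<mu>\<in>D // r. card (\<mu> \<times> \<mu>))"
  proof (rule card_UN_disjoint)
    show "finite (D // r)" using assms(1) \<open>r \<subseteq> D \<times> D\<close> by (simp add: finite_quotient)
    show "\<forall>\<mu>\<in>D // r. finite (\<mu> \<times> \<mu>)"
      using assms(1) \<open>r \<subseteq> D \<times> D\<close> by (simp add: finite_equiv_class)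
    show "\<forall>\<mu>\<in>D // r. \<forall>\<nu>\<in>D // r. \<mu> \<noteq> \<nu> \<longrightarrow> \<mu> \<times> \<mu> \<inter> \<nu> \<times> \<nu> = {}"
      using quotient_disj[OF assms(2)] by blast
  qed
  ultimately show ?thesis by (simp add: card_cartesian_product power2_eq_square)
qed

interpretation matrices: vector_space "\<lambda>c (A::complex^'n^'m). mat c ** A"
  by (rule vector_space_matrix)

text \<open>The projections cut \<open>Y\<close> into blocks \<open>P W ** Y ** P V\<close>. By
  Schur's lemma a block vanishes unless \<open>V\<close> and \<open>W\<close> are equivalent, and is
  then a multiple of one fixed intertwiner \<open>R V W ** P V\<close>. So there is one generator
  for each pair of equivalent summands, and the number of such pairs is the sum of the squared
  multiplicities.\<close>

lemma commutant_subset_span: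
  fixes U :: "'g \<Rightarrow> complex^'n^'n"
  assumes D: "irrep_decomposition G U D"
  obtains F :: "(complex^'n^'n) set" where "finite F"
    "card F \<le> (\<Sum>\<mu>\<in>irrep_classes G U D. (multiplicity_in D \<mu>)\<^sup>2)"
    "commutant G U \<subseteq> matrices.span F"
proof -
  define r where "r = {(V, W). V \<in> D \<and> W \<in> D \<and> equivalent_subreps G U V W}"
  have fin: "finite D" and irr: "\<And>V. V \<in> D \<Longrightarrow> irreducible_subspace G U V"
    using D by (auto simp: irrep_decomposition_def)
  have "r \<subseteq> D \<times> D" by (auto simp: r_def)
  then have finr: "finite r" using fin finite_subset by blast
  have "equiv D r"
    unfolding r_def using irr by (intro equiv_equivalent_subreps) (simp add: irreducible_subspace_def)
  then have "card r = (\<Sum>\<mu>\<in>D // r. (card \<mu>)\<^sup>2)"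
    using fin by (rule card_equiv_eq_sum_squares[rotated])
  also have "\<dots> = (\<Sum>\<mu>\<in>irrep_classes G U D. (multiplicity_in D \<mu>)\<^sup>2)"
  proof -
    have "{W \<in> D. W \<in> \<mu>} = \<mu>" if "\<mu> \<in> D // r" for \<mu>
      using in_quotient_imp_subset[OF \<open>equiv D r\<close> that] by blast
    then show ?thesis by (simp add: irrep_classes_def multiplicity_in_def flip: r_def)
  qed
  finally have card_r: "card r = \<dots>" .
  obtain P where PW: "\<And>W x. W \<in> D \<Longrightarrow> P W *v x \<in> W"
    and Psum: "\<And>x. (\<Sum>W\<in>D. P W *v x) = x"
    and Pcomm: "\<And>W. W \<in> D \<Longrightarrow> P W \<in> commutant G U"
    using irrep_decomposition_projections[OF D] by metis
  have "\<exists>R. bij_betw ((*v) R) V W \<and>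
      (\<forall>g\<in>carrier G. \<forall>v\<in>V. R *v (U g *v v) = U g *v (R *v v))" if "(V, W) \<in> r" for V W
    using that unfolding r_def equivalent_subreps_def by blast
  then obtain R where R: "\<And>V W. (V, W) \<in> r \<Longrightarrow> bij_betw ((*v) (R V W)) V W"
    "\<And>V W g v. (V, W) \<in> r \<Longrightarrow> g \<in> carrier G \<Longrightarrow> v \<in> V \<Longrightarrow> R V W *v (U g *v v) = U g *v (R V W *v v)"
    by metis
  let ?F = "(\<lambda>(V, W). R V W ** P V) ` r"
  have "Y \<in> matrices.span ?F" if Y: "Y \<in> commutant G U" for Y
  proof -
    have block: "P W ** Y ** P V \<in> matrices.span ?F" if "V \<in> D" "W \<in> D" for V W
    proof -
      let ?Z = "P W ** Y"
      have Z: "?Z \<in> commutant G U"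
        using Y Pcomm[OF \<open>W \<in> D\<close>] by (auto simp: commutant_def) (metis matrix_mul_assoc)
      have ZW: "?Z *v v \<in> W" for v
        using PW[OF \<open>W \<in> D\<close>] by (simp flip: matrix_vector_mul_assoc)
      show ?thesis
      proof (cases "(V, W) \<in> r")
        case True
        then obtain c where "\<forall>v\<in>V. ?Z *v v = c *s (R V W *v v)"
          using schur_scalar[OF irr[OF \<open>V \<in> D\<close>] R ZW Z] by blast
        then have "?Z ** P V = mat c ** (R V W ** P V)"
          using PW[OF \<open>V \<in> D\<close>] by (simp add: matrix_eq mat_mult_vec flip: matrix_vector_mul_assoc)
        moreover have "R V W ** P V \<in> matrices.span ?F"
          using True by (intro matrices.span_base) force
        ultimately show ?thesis by (simp add: matrices.span_scale)
      next
        case False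
        \<comment> \<open>A bijective \<open>?Z\<close> would itself be an equivalence of
          \<open>V\<close> and \<open>W\<close>, because it commutes with the
          representation.\<close>
        then have "\<not> bij_betw ((*v) ?Z) V W"
          using that Z unfolding r_def equivalent_subreps_def commutant_def
          by (auto simp: matrix_vector_mul_assoc)
        then have "\<forall>v\<in>V. ?Z *v v = 0"
          using schur_zero_or_bij[OF irr[OF \<open>V \<in> D\<close>] irr[OF \<open>W \<in> D\<close>] ZW Z] by blast
        then have "?Z ** P V = 0"
          using PW[OF \<open>V \<in> D\<close>] by (simp add: matrix_eq flip: matrix_vector_mul_assoc)
        then show ?thesis by (simp add: matrices.span_zero)
      qed
    qed
    have "Y *v x = (\<Sum>V\<in>D. \<Sum>W\<in>D. P W ** Y ** P V) *v x" for x
    proof -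
      have "(\<Sum>V\<in>D. \<Sum>W\<in>D. P W ** Y ** P V) *v x = (\<Sum>V\<in>D. \<Sum>W\<in>D. P W *v (Y *v (P V *v x)))"
        by (simp add: matrix_vector_mult_sum_left matrix_vector_mul_assoc matrix_mul_assoc)
      also have "\<dots> = Y *v (\<Sum>V\<in>D. P V *v x)"
        by (simp add: Psum flip: vec.linear_sum[OF matrix_vector_mul_linear_gen])
      finally show ?thesis by (simp add: Psum)
    qed
    then have "Y = (\<Sum>V\<in>D. \<Sum>W\<in>D. P W ** Y ** P V)" by (simp add: matrix_eq)
    also have "\<dots> \<in> matrices.span ?F"
      by (intro matrices.span_sum block)
    finally show ?thesis .
  qed
  moreover have "card ?F \<le> card r" using finr by (rule card_image_le)
  ultimately show thesis
    using that[of ?F] finr card_r by auto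
qed


section \<open>Twirling by the Haar measure\<close>

definition twirl :: "'g measure \<Rightarrow> ('g \<Rightarrow> complex^'n^'n) \<Rightarrow> complex^'n^'n \<Rightarrow> complex^'n^'n" where
  "twirl M U B = (\<integral>g. U g ** B ** adj (U g) \<partial>M)"

locale twirling = group G
  for G :: "('g, 'm) monoid_scheme" (structure) +
  fixes T :: "'g topology" and M :: "'g measure" and U :: "'g \<Rightarrow> complex^'n^'n"
  assumes topspace_eq: "topspace T = carrier G"
    and compact: "compact_space T"
    and continuous_mult: "continuous_map (prod_topology T T) T (\<lambda>(g, h). g \<otimes> h)"
    and haar: "normalized_haar_measure G T M"
    and rep: "projective_rep G T U"
begin

section \<open>Left translations and integrability\<close>

lemma space_haar: "space M = carrier G"
  and sets_haar: "sets M = sigma_sets (carrier G) {N. openin T N}"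
  and emeasure_left_coset: "g \<in> carrier G \<Longrightarrow> B \<in> sets M \<Longrightarrow> emeasure M (g <# B) = emeasure M B"
  using haar by (auto simp: normalized_haar_measure_def)

lemma finite_measure_haar: "finite_measure M"
  using haar by (intro finite_measureI) (auto simp: normalized_haar_measure_def)

lemma left_mult_measurable:
  assumes h: "h \<in> carrier G"
  shows "(\<lambda>g. h \<otimes> g) \<in> measurable M M"
proof (rule measurable_sigma_sets[OF sets_haar])
  show "{N. openin T N} \<subseteq> Pow (carrier G)"
    using openin_subset by (fastforce simp: topspace_eq)
  show "(\<lambda>g. h \<otimes> g) \<in> space M \<rightarrow> carrier G"
    using h by (auto simp: space_haar)
  fix N assume "N \<in> {N. openin T N}"
  moreover have "continuous_map T T ((\<lambda>(g, k). g \<otimes> k) \<circ> (\<lambda>g. (h, g)))"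
    using h by (intro continuous_map_compose[OF _ continuous_mult] continuous_map_pairedI)
      (simp_all add: topspace_eq)
  ultimately have "openin T {g \<in> topspace T. h \<otimes> g \<in> N}"
    by (auto simp: o_def dest: openin_continuous_map_preimage)
  moreover have "(\<lambda>g. h \<otimes> g) -` N \<inter> space M = {g \<in> topspace T. h \<otimes> g \<in> N}"
    by (auto simp: space_haar topspace_eq)
  ultimately show "(\<lambda>g. h \<otimes> g) -` N \<inter> space M \<in> sets M"
    by (simp add: sets_haar sigma_sets.Basic)
qed

text \<open>The preimage of \<open>B\<close> under multiplication by \<open>h\<close> is the left
  coset \<open>inv h <# B\<close>, which turns invariance on cosets into invariance of the measure
  under push-forward, as a change of variables requires.\<close>

lemma distr_left_mult:
  assumes h: "h \<in> carrier G"
  shows "distr M M (\<lambda>g. h \<otimes> g) = M"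
proof (rule measure_eqI)
  fix B assume "B \<in> sets (distr M M (\<lambda>g. h \<otimes> g))"
  then have B: "B \<in> sets M" by simp
  then have "B \<subseteq> carrier G" using sets.sets_into_space by (fastforce simp: space_haar)
  have "(\<lambda>g. h \<otimes> g) -` B \<inter> space M = inv h <# B"
  proof (intro equalityI subsetI)
    fix g assume "g \<in> (\<lambda>g. h \<otimes> g) -` B \<inter> space M"
    then have "g = inv h \<otimes> (h \<otimes> g)" "h \<otimes> g \<in> B"
      using h by (auto simp: space_haar simp flip: m_assoc)
    then show "g \<in> inv h <# B" by (auto simp: l_coset_def)
  next
    fix g assume "g \<in> inv h <# B"
    then obtain b where "b \<in> B" "g = inv h \<otimes> b" by (auto simp: l_coset_def)
    moreover from this have "b \<in> carrier G" using \<open>B \<subseteq> carrier G\<close> by blast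
    ultimately show "g \<in> (\<lambda>g. h \<otimes> g) -` B \<inter> space M"
      using h by (auto simp: space_haar simp flip: m_assoc)
  qed
  then show "emeasure (distr M M (\<lambda>g. h \<otimes> g)) B = emeasure M B"
    using B h by (simp add: emeasure_distr left_mult_measurable emeasure_left_coset)
qed simp

text \<open>The topology of the group is the object \<open>T\<close>, not a type class instance, so
  continuity is converted to measurability through preimages of open sets.\<close>

lemma conjugate_measurable: "(\<lambda>g. U g ** B ** adj (U g)) \<in> borel_measurable M"
proof (rule borel_measurableI)
  fix S :: "(complex^'n^'n) set" assume "open S"
  have "continuous_map T euclidean (\<lambda>g. U g ** B ** adj (U g))"
    using rep by (simp add: projective_rep_def)
  then have "openin T {g \<in> topspace T. U g ** B ** adj (U g) \<in> S}"
    using \<open>open S\<close> by (intro openin_continuous_map_preimage) auto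
  moreover have "(\<lambda>g. U g ** B ** adj (U g)) -` S \<inter> space M =
      {g \<in> topspace T. U g ** B ** adj (U g) \<in> S}"
    by (auto simp: space_haar topspace_eq)
  ultimately show "(\<lambda>g. U g ** B ** adj (U g)) -` S \<inter> space M \<in> sets M"
    by (simp add: sets_haar sigma_sets.Basic)
qed

text \<open>The integrand is continuous on a compact group, hence bounded, and the measure is
  finite.\<close>

lemma integrable_conjugate: "integrable M (\<lambda>g. U g ** B ** adj (U g))"
proof -
  interpret finite_measure M by (rule finite_measure_haar)
  have "continuous_map T euclidean (\<lambda>g. U g ** B ** adj (U g))"
    using rep by (simp add: projective_rep_def)
  then have "compactin euclidean ((\<lambda>g. U g ** B ** adj (U g)) ` carrier G)"
    using compact by (intro image_compactin[of T]) (simp_all add: compact_space_def topspace_eq)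
  then have "bounded ((\<lambda>g. U g ** B ** adj (U g)) ` carrier G)"
    by (simp add: compact_imp_bounded)
  then obtain K where "\<And>g. g \<in> carrier G \<Longrightarrow> norm (U g ** B ** adj (U g)) \<le> K"
    by (auto simp: bounded_iff)
  then show ?thesis
    by (intro integrable_const_bound[of _ K] AE_I2 conjugate_measurable) (simp add: space_haar)
qed

section \<open>Algebraic properties of the twirl\<close>

lemma linear_twirl: "linear (twirl M U)"
proof (rule linearI)
  interpret conj: bounded_linear "\<lambda>B. U g ** B ** adj (U g)" for g
    by (rule bounded_linear_sandwich)
  show "twirl M U (A + B) = twirl M U A + twirl M U B" for A B
    unfolding twirl_def by (simp add: conj.add integrable_conjugate)
  show "twirl M U (r *\<^sub>R A) = r *\<^sub>R twirl M U A" for r A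
    unfolding twirl_def by (simp add: conj.scaleR)
qed

lemma twirl_scale: "twirl M U (mat c ** B) = mat c ** twirl M U B"
proof -
  \<comment> \<open>The trailing \<open>mat 1\<close> gives the integrand the two-sided shape of
    \<open>bounded_linear_sandwich\<close>.\<close>
  have "U g ** (mat c ** B) ** adj (U g) = mat c ** (U g ** B ** adj (U g)) ** mat 1" for g
    by (simp add: matrix_mul_assoc mat_mult_commute[of "U g" c])
  then show ?thesis
    unfolding twirl_def
    using integral_bounded_linear[OF bounded_linear_sandwich[of "mat c" "mat 1"]
        integrable_conjugate[of B]]
    by simp
qed

lemma twirl_adj: "twirl M U (adj B) = adj (twirl M U B)"
proof -
  have "U g ** adj B ** adj (U g) = adj (U g ** B ** adj (U g))" for g
    by (simp add: adj_mult matrix_mul_assoc)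
  then show ?thesis
    unfolding twirl_def
    using integral_bounded_linear[OF bounded_linear_adj integrable_conjugate] by simp
qed

text \<open>Conjugation by \<open>U h\<close> replaces the integrand at g by the integrand at the
  product of h and g: the multiplier appears once as itself and once conjugated, and the two cancel
  because it has modulus 1. Left invariance then restores the integral.\<close>

lemma twirl_in_commutant: "twirl M U B \<in> commutant G U"
  unfolding commutant_def
proof (intro CollectI ballI)
  fix h assume h: "h \<in> carrier G"
  obtain \<omega> where \<omega>: "\<And>g. g \<in> carrier G \<Longrightarrow>
      cmod (\<omega> h g) = 1 \<and> U h ** U g = mat (\<omega> h g) ** U (h \<otimes> g)"
    using rep h unfolding projective_rep_def by blast
  let ?f = "\<lambda>g. U g ** B ** adj (U g)"
  have step: "U h ** ?f g ** adj (U h) = ?f (h \<otimes> g)" if "g \<in> carrier G" for g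
  proof -
    have "U h ** ?f g ** adj (U h) = (U h ** U g) ** B ** adj (U h ** U g)"
      by (simp add: adj_mult matrix_mul_assoc)
    also have "\<dots> = mat (\<omega> h g) ** U (h \<otimes> g) ** B ** (adj (U (h \<otimes> g)) ** mat (cnj (\<omega> h g)))"
      using \<omega>[OF that] by (simp add: adj_mult adj_mat)
    also have "\<dots> = mat (cnj (\<omega> h g)) ** mat (\<omega> h g) ** ?f (h \<otimes> g)"
      by (simp add: matrix_mul_assoc
          mat_mult_commute[of "mat (\<omega> h g) ** U (h \<otimes> g) ** B ** adj (U (h \<otimes> g))"])
    also have "\<dots> = ?f (h \<otimes> g)"
      using \<omega>[OF that] by (simp add: mat_mult_mat mult.commute[of "cnj _"]
          flip: complex_norm_square)
    finally show ?thesis .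
  qed
  have "U h ** twirl M U B ** adj (U h) = (\<integral>g. U h ** ?f g ** adj (U h) \<partial>M)"
    unfolding twirl_def
    by (rule integral_bounded_linear[OF bounded_linear_sandwich integrable_conjugate, symmetric])
  also have "\<dots> = (\<integral>g. ?f (h \<otimes> g) \<partial>M)"
    by (rule Bochner_Integration.integral_cong[OF refl]) (simp only: space_haar step)
  also have "\<dots> = (\<integral>g. ?f g \<partial>distr M M (\<lambda>g. h \<otimes> g))"
    by (rule integral_distr[OF left_mult_measurable[OF h] conjugate_measurable, symmetric])
  also have "\<dots> = twirl M U B"
    by (simp add: distr_left_mult[OF h] twirl_def)
  finally have "U h ** twirl M U B ** (adj (U h) ** U h) = twirl M U B ** U h"
    by (metis matrix_mul_assoc)
  moreover have "adj (U h) ** U h = mat 1"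
    using rep h by (simp add: projective_rep_def unitary_def)
  ultimately show "U h ** twirl M U B = twirl M U B ** U h" by simp
qed

end


section \<open>Perturbation of seeds\<close>

text \<open>The first hypothesis is the injectivity supplied by \<open>rank_support\<close>. The
  columns of \<open>N ** X\<close> are supported on \<open>J\<close>, so \<open>adj X\<close> can be
  cancelled and \<open>N ** X = 0\<close>. Taking adjoints puts \<open>adj X\<close> on the left
  again, and a second cancellation gives \<open>adj N = 0\<close>.\<close>

lemma sandwich_eq_0_imp:
  fixes X N :: "complex^'n^'n"
  assumes inj: "\<And>y. adj X *v y = 0 \<Longrightarrow> \<forall>j. j \<notin> J \<longrightarrow> y $ j = 0 \<Longrightarrow> y = 0"
    and N: "\<And>j k. j \<notin> J \<or> k \<notin> J \<Longrightarrow> N $ j $ k = 0"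
    and eq: "adj X ** N ** X = 0"
  shows "N = 0"
proof -
  have "(N ** X) *v x = 0" for x
  proof (rule inj)
    show "adj X *v ((N ** X) *v x) = 0"
      using eq by (simp add: matrix_vector_mul_assoc matrix_mul_assoc)
    show "\<forall>j. j \<notin> J \<longrightarrow> ((N ** X) *v x) $ j = 0"
      unfolding matrix_vector_mul_assoc[symmetric]
      using N by (simp add: matrix_vector_mult_def[of N])
  qed
  then have "N ** X = 0" by (simp add: matrix_eq)
  then have "adj X ** adj N = 0" by (metis adj_mult adj_zero)
  have "adj N *v x = 0" for x
  proof (rule inj)
    show "adj X *v (adj N *v x) = 0"
      using \<open>adj X ** adj N = 0\<close> by (simp add: matrix_vector_mul_assoc)
    show "\<forall>j. j \<notin> J \<longrightarrow> (adj N *v x) $ j = 0"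
      using N by (simp add: matrix_vector_mult_def adj_component)
  qed
  then have "adj N = 0" by (simp add: matrix_eq)
  then show ?thesis by (metis adj_adj adj_zero)
qed

context twirling
begin

text \<open>The matrix units at the positions in \<open>J i \<times> J i\<close>, over all i,
  outnumber \<open>F\<close>, so their twirled sandwiches satisfy a linear relation. Its
  coefficients are the entries of the matrices \<open>N i\<close>. The set \<open>J i\<close> is
  returned as well, because the injectivity on its support is needed again for the Hermitian
  part.\<close>

lemma ex_twirl_relation:
  fixes X :: "'i::finite \<Rightarrow> complex^'n^'n"
  assumes F: "finite F" "commutant G U \<subseteq> matrices.span F" "card F < (\<Sum>i\<in>UNIV. (rank (X i))\<^sup>2)"
  obtains J :: "'i \<Rightarrow> 'n set" and N :: "'i \<Rightarrow> complex^'n^'n" where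
    "\<And>i y. adj (X i) *v y = 0 \<Longrightarrow> \<forall>j. j \<notin> J i \<longrightarrow> y $ j = 0 \<Longrightarrow> y = 0"
    "\<And>i j k. j \<notin> J i \<or> k \<notin> J i \<Longrightarrow> N i $ j $ k = 0"
    "\<exists>i. N i \<noteq> 0"
    "(\<Sum>i\<in>UNIV. twirl M U (adj (X i) ** N i ** X i)) = 0"
proof -
  have "\<exists>J. card J = rank (X i) \<and>
      (\<forall>y. adj (X i) *v y = 0 \<longrightarrow> (\<forall>j. j \<notin> J \<longrightarrow> y $ j = 0) \<longrightarrow> y = 0)" for i
    using rank_support[of "X i"] by metis
  then obtain J where card_J: "\<And>i. card (J i) = rank (X i)"
    and inj: "\<And>i y. adj (X i) *v y = 0 \<Longrightarrow> \<forall>j. j \<notin> J i \<longrightarrow> y $ j = 0 \<Longrightarrow> y = 0"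
    by metis
  define L where "L i B = twirl M U (adj (X i) ** B ** X i)" for i B
  have linear_L: "linear (L i)" for i
    unfolding L_def[abs_def]
    using linear_compose[OF bounded_linear.linear[OF bounded_linear_sandwich] linear_twirl]
    by (simp add: o_def)
  have L_scale: "L i (mat c ** B) = mat c ** L i B" for i c B
    unfolding L_def twirl_scale[symmetric]
    by (simp add: matrix_mul_assoc mat_mult_commute[of "adj (X i)"])
  define E :: "'n \<times> 'n \<Rightarrow> complex^'n^'n"
    where "E p = (\<chi> a b. if (a, b) = p then 1 else 0)" for p
  define S where "S = (SIGMA i:UNIV. J i \<times> J i)"
  have "card S = (\<Sum>i\<in>UNIV. (rank (X i))\<^sup>2)"
    by (simp add: S_def card_SigmaI card_cartesian_product card_J power2_eq_square)
  moreover have "finite S" by (simp add: S_def)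
  moreover have "(\<lambda>(i, p). L i (E p)) ` S \<subseteq> matrices.span F"
    using F(2) twirl_in_commutant by (auto simp: L_def)
  ultimately obtain c where c: "\<exists>s\<in>S. c s \<noteq> 0"
    "(\<Sum>s\<in>S. mat (c s) ** (case s of (i, p) \<Rightarrow> L i (E p))) = 0"
    using matrices.linear_relation_if_card_less[OF _ F(1), of S "\<lambda>(i, p). L i (E p)"] F(3) by auto
  define N where "N i = (\<Sum>p\<in>J i \<times> J i. mat (c (i, p)) ** E p)" for i
  have N: "N i $ j $ k = (if j \<in> J i \<and> k \<in> J i then c (i, j, k) else 0)" for i j k
  proof -
    have "N i $ j $ k = (\<Sum>p\<in>J i \<times> J i. if (j, k) = p then c (i, p) else 0)"
      by (simp add: N_def E_def if_distrib cong: if_cong)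
    also have "\<dots> = (if j \<in> J i \<and> k \<in> J i then c (i, j, k) else 0)"
      by simp
    finally show ?thesis .
  qed
  have "(\<Sum>i\<in>UNIV. L i (N i)) = (\<Sum>i\<in>UNIV. \<Sum>p\<in>J i \<times> J i. mat (c (i, p)) ** L i (E p))"
    by (simp add: N_def linear_sum[OF linear_L] L_scale)
  also have "\<dots> = 0"
    using c(2) by (simp add: S_def sum.Sigma split_beta)
  finally have "(\<Sum>i\<in>UNIV. twirl M U (adj (X i) ** N i ** X i)) = 0"
    by (simp add: L_def)
  moreover obtain i j k where "j \<in> J i" "k \<in> J i" "c (i, j, k) \<noteq> 0"
    using c(1) by (auto simp: S_def)
  then have "N i $ j $ k \<noteq> 0" by (simp add: N)
  then have "N i \<noteq> 0" by auto
  ultimately show thesis using that[of J N] inj N by metis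
qed

text \<open>If the Hermitian part of a solution vanishes, then \<open>\<i>\<close> times the solution is Hermitian.\<close>

lemma ex_hermitian_twirl_relation:
  fixes X :: "'i::finite \<Rightarrow> complex^'n^'n"
  assumes F: "finite F" "commutant G U \<subseteq> matrices.span F" "card F < (\<Sum>i\<in>UNIV. (rank (X i))\<^sup>2)"
  obtains N :: "'i \<Rightarrow> complex^'n^'n" where
    "\<And>i. adj (N i) = N i"
    "\<exists>i. adj (X i) ** N i ** X i \<noteq> 0"
    "(\<Sum>i\<in>UNIV. twirl M U (adj (X i) ** N i ** X i)) = 0"
proof -
  obtain J N where inj: "\<And>i y. adj (X i) *v y = 0 \<Longrightarrow> \<forall>j. j \<notin> J i \<longrightarrow> y $ j = 0 \<Longrightarrow> y = 0"
    and N: "\<And>i j k. j \<notin> J i \<or> k \<notin> J i \<Longrightarrow> N i $ j $ k = 0" "\<exists>i. N i \<noteq> 0"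
      "(\<Sum>i\<in>UNIV. twirl M U (adj (X i) ** N i ** X i)) = 0"
    by (rule ex_twirl_relation[OF F]) (rule that)
  have nonzero: "\<exists>i. adj (X i) ** N' i ** X i \<noteq> 0"
    if supp: "\<And>i j k. j \<notin> J i \<or> k \<notin> J i \<Longrightarrow> N' i $ j $ k = 0" and ne: "\<exists>i. N' i \<noteq> 0" for N'
  proof -
    obtain i where "N' i \<noteq> 0" using ne by blast
    then have "adj (X i) ** N' i ** X i \<noteq> 0"
      using sandwich_eq_0_imp[of "X i" "J i" "N' i"] inj supp by blast
    then show ?thesis by blast
  qed
  show thesis
  proof (cases "\<forall>i. N i + adj (N i) = 0")
    case True
    then have "adj (N i) = - N i" for i
      by (simp add: eq_neg_iff_add_eq_0 add.commute)
    then have "adj (mat \<i> ** N i) = mat \<i> ** N i" for i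
      by (simp add: adj_mult adj_mat mat_mult_commute[of "- N i"])
    moreover have "mat \<i> ** N i \<noteq> 0" if "N i \<noteq> 0" for i
      using that by (simp add: vec_eq_iff)
    then have "\<exists>i. adj (X i) ** (mat \<i> ** N i) ** X i \<noteq> 0"
      using N(1,2) by (intro nonzero) (simp, blast)
    moreover have "adj (X i) ** (mat \<i> ** N i) ** X i = mat \<i> ** (adj (X i) ** N i ** X i)" for i
      by (simp add: matrix_mul_assoc mat_mult_commute[of "adj (X i)"])
    then have "(\<Sum>i\<in>UNIV. twirl M U (adj (X i) ** (mat \<i> ** N i) ** X i)) = 0"
      using N(3) by (simp add: twirl_scale flip: matrices.scale_sum_right)
    ultimately show ?thesis by (rule that)
  next
    case False
    let ?H = "\<lambda>i. N i + adj (N i)"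
    have "adj (?H i) = ?H i" for i
      by (simp add: adj_add add.commute)
    \<comment> \<open>The square of \<open>J i\<close> is symmetric under transposition, so
      \<open>?H i\<close> is supported there too.\<close>
    moreover have "\<exists>i. adj (X i) ** ?H i ** X i \<noteq> 0"
      using N(1) False by (intro nonzero) (auto simp: adj_component)
    moreover have "adj (X i) ** ?H i ** X i = adj (X i) ** N i ** X i + adj (adj (X i) ** N i ** X i)" for i
      by (simp only: adj_mult adj_adj matrix_mul_assoc
          linear_add[OF bounded_linear.linear[OF bounded_linear_sandwich]])
    \<comment> \<open>The twirls of the adjoint tuple sum to the adjoint of the original sum, which
      is 0.\<close>
    then have "(\<Sum>i\<in>UNIV. twirl M U (adj (X i) ** ?H i ** X i)) = 0"
      using N(3) by (simp add: linear_add[OF linear_twirl] twirl_adj sum.distrib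
          flip: linear_sum[OF bounded_linear.linear[OF bounded_linear_adj]])
    ultimately show ?thesis by (rule that)
  qed
qed

end

text \<open>With y = \<open>X *v x\<close> the quadratic form is the squared norm of y plus t times
  the form of \<open>N\<close> at y. The latter is real since \<open>N\<close> is Hermitian, and by
  Cauchy-Schwarz its multiple by t is at most the former in absolute value.\<close>

lemma pos_op_perturbed:
  fixes X N :: "complex^'n^'n"
  assumes "adj N = N" and K: "\<And>y. norm (N *v y) \<le> K * norm y" and t: "\<bar>t\<bar> * K \<le> 1"
  shows "pos_op (adj X ** X + mat (of_real t) ** (adj X ** N ** X))"
  unfolding pos_op_def
proof
  fix x
  define y where "y = X *v x"
  have eq: "cinner x ((adj X ** X + mat (of_real t) ** (adj X ** N ** X)) *v x) =
      cinner y y + of_real t * cinner y (N *v y)"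
    by (simp add: y_def matrix_vector_mult_add_rdistrib cinner_add_right mat_mult_vec
        cinner_scale_right cinner_adj flip: matrix_vector_mul_assoc)
  have "cnj (cinner y (N *v y)) = cinner y (N *v y)"
    by (metis assms(1) cinner_adj cnj_cinner)
  then have "cinner y (N *v y) \<in> \<real>" "cinner y y \<in> \<real>"
    by (simp_all add: Reals_cnj_iff cnj_cinner)
  moreover have "\<bar>t * (y \<bullet> (N *v y))\<bar> \<le> y \<bullet> y"
  proof -
    have "\<bar>t * (y \<bullet> (N *v y))\<bar> \<le> \<bar>t\<bar> * (norm y * (K * norm y))"
      unfolding abs_mult
      by (intro mult_left_mono order_trans[OF Cauchy_Schwarz_ineq2] K) auto
    also have "\<dots> = (\<bar>t\<bar> * K) * (norm y)\<^sup>2" by (simp add: power2_eq_square)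
    also have "\<dots> \<le> 1 * (norm y)\<^sup>2" by (rule mult_right_mono[OF t]) simp
    finally show ?thesis by (simp add: power2_norm_eq_inner)
  qed
  ultimately show "cinner x ((adj X ** X + mat (of_real t) ** (adj X ** N ** X)) *v x) \<in> \<real> \<and>
      0 \<le> Re (cinner x ((adj X ** X + mat (of_real t) ** (adj X ** N ** X)) *v x))"
    unfolding eq by (simp add: Re_cinner Re_complex_of_real abs_le_iff)
qed

theorem corollary2:
  fixes G :: "('g, 'm) monoid_scheme"
    and T :: "'g topology"
    and E :: "'e::euclidean_space set"
    and charts :: "('g set \<times> ('g \<Rightarrow> 'e)) set"
    and M :: "'g measure"
    and U :: "'g \<Rightarrow> complex^'n^'n"
    and D :: "(complex^'n) set set"
    and X :: "'i::finite \<Rightarrow> complex^'n^'n"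
    and A :: "complex^'n^'n^'i"
  assumes "compact_lie_group G T E charts"
    and "normalized_haar_measure G T M"
    and "projective_rep G T U"
    and "irrep_decomposition G U D"
    and "A = (\<chi> i. adj (X i) ** X i)"
    and "A \<in> seed_set M U"
    and "A extreme_point_of (seed_set M U)"
  shows "(\<Sum>i\<in>UNIV. (rank (X i))\<^sup>2) \<le> (\<Sum>\<mu>\<in>irrep_classes G U D. (multiplicity_in D \<mu>)\<^sup>2)"
proof (rule ccontr)
  assume "\<not> ?thesis"
  interpret lie: compact_lie_group G T E charts by fact
  interpret twirling G T M U
    by unfold_locales (use assms lie.topspace_eq lie.compact lie.continuous_mult in auto)
  obtain F where F: "finite F" "commutant G U \<subseteq> matrices.span F"
    "card F \<le> (\<Sum>\<mu>\<in>irrep_classes G U D. (multiplicity_in D \<mu>)\<^sup>2)"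
    using commutant_subset_span[OF assms(4)] by metis
  with \<open>\<not> ?thesis\<close> have "card F < (\<Sum>i\<in>UNIV. (rank (X i))\<^sup>2)" by simp
  then obtain N where herm: "\<And>i. adj (N i) = N i"
    and nonzero: "\<exists>i. adj (X i) ** N i ** X i \<noteq> 0"
    and rel: "(\<Sum>i\<in>UNIV. twirl M U (adj (X i) ** N i ** X i)) = 0"
    by (rule ex_hermitian_twirl_relation[OF F(1,2)]) (rule that)
  have "\<exists>K>0. \<forall>y. norm (N i *v y) \<le> K * norm y" for i
    using linear_bounded_pos[OF matrix_vector_mul_linear, of "N i"] by metis
  then obtain K where K: "\<And>i. K i > 0" "\<And>i y. norm (N i *v y) \<le> K i * norm y" by metis
  \<comment> \<open>A single step size serves all blocks: each \<open>K i\<close> is positive and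
    hence bounded by the sum, which gives the bound that \<open>pos_op_perturbed\<close>
    requires.\<close>
  define \<epsilon> where "\<epsilon> = inverse (\<Sum>i\<in>UNIV. K i)"
  have sumK: "(\<Sum>i\<in>UNIV. K i) > 0" using K(1) by (simp add: sum_pos)
  then have "\<epsilon> > 0" by (simp add: \<epsilon>_def)
  have \<epsilon>K: "\<epsilon> * K i \<le> 1" for i
  proof -
    have "K i \<le> (\<Sum>i\<in>UNIV. K i)" using K(1) by (intro member_le_sum) (auto simp: less_imp_le)
    then show ?thesis using sumK by (simp add: \<epsilon>_def field_simps)
  qed
  define P where "P t = (\<chi> i. mat (of_real t) ** (adj (X i) ** N i ** X i))" for t :: real
  have mem: "A + P t \<in> seed_set M U" if "\<bar>t\<bar> = \<epsilon>" for t
  proof -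
    have "(\<Sum>i\<in>UNIV. twirl M U ((A + P t) $ i)) =
        (\<Sum>i\<in>UNIV. twirl M U (A $ i)) +
        mat (of_real t) ** (\<Sum>i\<in>UNIV. twirl M U (adj (X i) ** N i ** X i))"
      by (simp add: P_def linear_add[OF linear_twirl] sum.distrib twirl_scale
          matrices.scale_sum_right)
    also have "\<dots> = mat 1"
      using assms(6) rel by (simp add: seed_set_def twirl_def)
    finally show ?thesis
      unfolding seed_set_def twirl_def
      using pos_op_perturbed[OF herm K(2)] \<epsilon>K that by (simp add: P_def assms(5))
  qed
  have "P (- \<epsilon>) = - P \<epsilon>"
    by (simp add: P_def vec_eq_iff)
  then have "midpoint (A + P \<epsilon>) (A + P (- \<epsilon>)) = A"
    by (simp add: midpoint_def flip: scaleR_2)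
  \<comment> \<open>The two endpoints must be distinct for their midpoint to lie in the open
    segment.\<close>
  moreover have "P \<epsilon> \<noteq> 0"
    using nonzero \<open>\<epsilon> > 0\<close> by (auto simp: P_def vec_eq_iff)
  then have "A + P \<epsilon> \<noteq> A + P (- \<epsilon>)"
    unfolding \<open>P (- \<epsilon>) = - P \<epsilon>\<close> by (auto simp: vec_eq_iff)
  ultimately have "A \<in> open_segment (A + P \<epsilon>) (A + P (- \<epsilon>))"
    by (metis midpoint_in_open_segment)
  then show False
    using assms(7) mem[of \<epsilon>] mem[of "- \<epsilon>"] \<open>\<epsilon> > 0\<close> unfolding extreme_point_of_def by simp
qed

end
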